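(* For each integer $c \geq 1$, let $P_c(x) = \frac{1}{2^c c!}\left(\frac{d}{dx}\right)^c (x^2-1)^c$ be the $c$th Legendre polynomial, and let $x_{1,c} < x_{2,c} < \cdots < x_{c,c}$ be its $c$ simple roots in $(-1,1)$. For $1 \leq k \leq c$ define $$p_{k,c} = \frac{x_{k,c}+1}{2}, \qquad w_{k,c} = \frac{2}{(1-x_{k,c}^2)^{3/2}\, P_c'(x_{k,c})^2}, \qquad N_c = \sum_{k=1}^c w_{k,c}.$$ Let $\alpha > 0$, and let $k$ satisfy $\alpha c < k < (1-\alpha)c$. Then, as $c \to \infty$, $$p_{k,c} = \sin^2\!\left(\frac{\pi k}{2c}\right) + o(1), \qquad w_{k,c} = \frac{\pi}{c} + o\!\left(\frac{1}{c}\right), \qquad N_c = \pi - o(1).$$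
   Context: The quantities $p_{k,c}$, $w_{k,c}$, $N_c$ are the points, weights and normalizing constant of the discrete (Gauss–Legendre) distribution function $F_{2c-1}(p) = F_{2c}(p) = \frac{1}{N_c}\sum_{k=1}^c w_{k,c} H(p - p_{k,c})$ on $[0,1]$ ($H$ the Heaviside step function), which was shown by Nuida et al. to be the optimal bias distribution (maximizing expected coalition score) in the symmetric Tardos fingerprinting scheme against $2c-1$ or $2c$ colluders. *)

theory Defs
  imports "HOL-Analysis.Analysis" "HOL-Computational_Algebra.Polynomial"
begin

definition legendre :: "nat \<Rightarrow> real poly" where
  "legendre c = smult (1 / (2 ^ c * fact c)) ((pderiv ^^ c) ([:-1, 0, 1:] ^ c))"

definition leg_root :: "nat \<Rightarrow> nat \<Rightarrow> real" where
  "leg_root k c = sorted_list_of_set {x. poly (legendre c) x = 0} ! (k - 1)"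

definition p_pt :: "nat \<Rightarrow> nat \<Rightarrow> real" where
  "p_pt k c = (leg_root k c + 1) / 2"

definition w_wt :: "nat \<Rightarrow> nat \<Rightarrow> real" where
  "w_wt k c = 2 / ((1 - (leg_root k c)\<^sup>2) powr (3/2) * (poly (pderiv (legendre c)) (leg_root k c))\<^sup>2)"

definition N_const :: "nat \<Rightarrow> real" where
  "N_const c = (\<Sum>k=1..c. w_wt k c)"

end

theory Submission
  imports Defs
begin

text \<open>
  With \<open>N = c + 1/2\<close>, the function \<open>u t = sqrt (sin t) * P(- cos t)\<close> turns Legendre's equation into
  \<open>u'' + q u = 0\<close> with \<open>q t = N\<^sup>2 + 1 / (4 (sin t)\<^sup>2)\<close>. Since \<open>q > N\<^sup>2\<close>, Sturm comparison with
  \<open>sin (N (t - a))\<close> gives a zero in every interval of length \<open>pi / N\<close> inside \<open>(0, pi)\<close>; there is room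
  for \<open>c\<close> disjoint such intervals, so they contain all the roots, exactly one each.

  The energy \<open>E = u'\<^sup>2 + q u\<^sup>2\<close> satisfies \<open>E' = q' u\<^sup>2\<close>. It is therefore minimal at \<open>pi / 2\<close> and, away
  from the end points, constant up to a factor \<open>1 + O(1 / N\<^sup>2)\<close>, and at the root with angle \<open>t\<close> the weight is
  exactly \<open>2 / E t\<close>. The value \<open>E (pi / 2)\<close> is expressed by a central binomial coefficient, so by Wallis'
  product it is asymptotic to \<open>2 c / pi\<close>. The minimality at \<open>pi / 2\<close> bounds all weights from above, including
  those near the end points, which yields the limit of the sum.
\<close>

section \<open>Legendre's equation and the values at the origin\<close>

text \<open>Repeated differentiation of \<open>(x^2 - 1) f' = 2 n x f\<close>. Keeping
  \<open>m\<close> general lets the induction run; at \<open>m = n\<close> the coefficients become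
  \<open>2\<close> and \<open>- n (n + 1)\<close>, which is Legendre's equation.\<close>

lemma legendre_poly_ode_aux:
  fixes n m :: nat
  defines "f \<equiv> [:-1, 0, 1::real:] ^ n"
  shows "[:-1, 0, 1:] * (pderiv ^^ (m + 2)) f
       + smult (2 * (real m + 1 - real n)) ([:0, 1:] * (pderiv ^^ (m + 1)) f)
       + smult ((real m + 1) * (real m - 2 * real n)) ((pderiv ^^ m) f) = 0"
proof (induction m)
  case 0
  have base: "[:-1, 0, 1:] * pderiv f = smult (2 * real n) ([:0, 1:] * f)"
  proof (cases n)
    case (Suc k)
    have "pderiv f = smult (real (Suc k)) ([:-1, 0, 1:] ^ k * pderiv [:-1, 0, 1:])"
      unfolding f_def Suc by (simp only: pderiv_power_Suc mult_smult_left)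
    moreover have "pderiv [:-1, 0, 1::real:] = smult 2 [:0, 1:]"
      by (simp add: pderiv_pCons)
    ultimately show ?thesis
      unfolding f_def Suc by (simp add: ac_simps)
  qed (simp add: f_def)
  have "[:-1, 0, 1:] * pderiv (pderiv f) + pderiv f * pderiv [:-1, 0, 1:]
      = smult (2 * real n) ([:0, 1:] * pderiv f + f * pderiv [:0, 1:])"
    using arg_cong [OF base, of pderiv] by (simp only: pderiv_mult pderiv_smult)
  then show ?case
    by (simp add: poly_eq_poly_eq_iff [symmetric] fun_eq_iff pderiv_pCons algebra_simps)
next
  case (Suc m)
  have "[:-1, 0, 1:] * (pderiv ^^ (m + 3)) f + (pderiv ^^ (m + 2)) f * pderiv [:-1, 0, 1:]
       + smult (2 * (real m + 1 - real n)) ([:0, 1:] * (pderiv ^^ (m + 2)) f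
           + (pderiv ^^ (m + 1)) f * pderiv [:0, 1:])
       + smult ((real m + 1) * (real m - 2 * real n)) ((pderiv ^^ (m + 1)) f) = 0"
    using arg_cong [OF Suc.IH, of pderiv]
    by (simp only: pderiv_add pderiv_mult pderiv_smult pderiv_0 numeral_2_eq_2 numeral_3_eq_3
        add_Suc_right add_0_right One_nat_def funpow.simps o_apply)
  then show ?case
    by (simp add: poly_eq_poly_eq_iff [symmetric] fun_eq_iff pderiv_pCons numeral_3_eq_3 algebra_simps)
qed

lemma legendre_ode:
  "(1 - x\<^sup>2) * poly (pderiv (pderiv (legendre n))) x
     = 2 * x * poly (pderiv (legendre n)) x - real n * (real n + 1) * poly (legendre n) x"
proof -
  define c :: real where "c = 1 / (2 ^ n * fact n)"
  define g where "g = (pderiv ^^ n) ([:-1, 0, 1::real:] ^ n)"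
  have L: "legendre n = smult c g"
    by (simp add: legendre_def c_def g_def)
  have "poly ([:-1, 0, 1:] * pderiv (pderiv g) + smult 2 ([:0, 1:] * pderiv g)
       + smult ((real n + 1) * (- real n)) g) x = 0"
    using legendre_poly_ode_aux [where n = n and m = n] by (simp add: g_def)
  then have "(1 - x\<^sup>2) * poly (pderiv (pderiv g)) x
     = 2 * x * poly (pderiv g) x - real n * (real n + 1) * poly g x"
    by (simp add: algebra_simps power2_eq_square)
  then have "c * ((1 - x\<^sup>2) * poly (pderiv (pderiv g)) x)
     = c * (2 * x * poly (pderiv g) x - real n * (real n + 1) * poly g x)"
    by simp
  then show ?thesis
    by (simp add: L pderiv_smult algebra_simps)
qed

lemma degree_legendre_le: "degree (legendre n) \<le> n"
proof -
  have "degree ([:-1, 0, 1::real:] ^ n) \<le> 2 * n"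
    using degree_power_le [of "[:-1, 0, 1::real:]" n] by simp
  then show ?thesis
    by (auto simp: legendre_def degree_higher_pderiv)
qed

section \<open>Coefficients of \<open>(x^2 - 1)^n\<close>, values at 0, and Wallis' product\<close>

lemma coeff_x2_minus_1_power:
  "coeff ([:-1, 0, 1::real:] ^ n) (2 * i) = (-1) ^ (n + i) * real (n choose i)"
  "coeff ([:-1, 0, 1::real:] ^ n) (2 * i + 1) = 0"
proof (induction n arbitrary: i)
  case 0
  { case 1 show ?case by (cases i) auto }
  { case 2 show ?case by simp }
next
  case (Suc n)
  \<comment> \<open>Written with a shift by two places, multiplication by \<open>x^2 - 1\<close>
    becomes Pascal's rule for the coefficients.\<close>
  have rec: "[:-1, 0, 1::real:] * q = smult (-1) q + pCons 0 (pCons 0 q)" for q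
    by simp
  { case 1 show ?case
    proof (cases i)
      case 0
      then show ?thesis using Suc(1) [of 0] by (simp add: rec del: mult_pCons_left)
    next
      case (Suc j)
      have "coeff ([:-1, 0, 1::real:] ^ Suc n) (2 * Suc j)
          = - coeff ([:-1, 0, 1::real:] ^ n) (2 * Suc j) + coeff ([:-1, 0, 1::real:] ^ n) (2 * j)"
        by (simp add: rec del: mult_pCons_left)
      also have "\<dots> = (-1) ^ (Suc n + Suc j) * real (Suc n choose Suc j)"
        unfolding Suc.IH by (simp add: algebra_simps)
      finally show ?thesis using Suc by simp
    qed }
  { case 2 show ?case
    proof (cases i)
      case 0
      then show ?thesis using Suc(2) [of 0] by (simp add: rec del: mult_pCons_left)
    next
      case (Suc j)
      have "coeff ([:-1, 0, 1::real:] ^ Suc n) (2 * Suc j + 1)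
          = - coeff ([:-1, 0, 1::real:] ^ n) (2 * Suc j + 1) + coeff ([:-1, 0, 1::real:] ^ n) (2 * j + 1)"
        by (simp add: rec del: mult_pCons_left)
      then show ?thesis unfolding Suc.IH Suc by simp
    qed }
qed

text \<open>At 0 the \<open>n\<close>-fold derivative leaves \<open>n!\<close> times the coefficient
  of index \<open>n\<close>; the \<open>n!\<close> cancels against the normalization.\<close>

lemma poly_legendre_0: "poly (legendre n) 0 = coeff ([:-1, 0, 1:] ^ n) n / 2 ^ n"
  by (simp add: poly_0_coeff_0 legendre_def coeff_higher_pderiv flip: pochhammer_fact)

lemma poly_pderiv_legendre_0:
  "poly (pderiv (legendre n)) 0 = (real n + 1) * coeff ([:-1, 0, 1:] ^ n) (n + 1) / 2 ^ n"
proof -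
  have "pochhammer 2 n = (real n + 1) * fact n"
    using pochhammer_rec [of "1::real" n] by (simp add: add.commute flip: pochhammer_fact)
  then show ?thesis
    by (simp add: poly_0_coeff_0 coeff_pderiv legendre_def coeff_higher_pderiv)
qed

text \<open>The probability of exactly \<open>m\<close> heads in \<open>2 m\<close> tosses of a fair
  coin.\<close>

abbreviation central_prob :: "nat \<Rightarrow> real" where
  "central_prob m \<equiv> real ((2 * m) choose m) / 4 ^ m"

lemma legendre_at_0_even:
  "(poly (legendre (2 * m)) 0)\<^sup>2 = (central_prob m)\<^sup>2"
  "poly (pderiv (legendre (2 * m))) 0 = 0"
proof -
  show "(poly (legendre (2 * m)) 0)\<^sup>2 = (central_prob m)\<^sup>2"
    unfolding poly_legendre_0 coeff_x2_minus_1_power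
    by (simp add: power_divide power_mult_distrib flip: power_mult power_mult [of "2::real" 2, simplified])
  show "poly (pderiv (legendre (2 * m))) 0 = 0"
    unfolding poly_pderiv_legendre_0 coeff_x2_minus_1_power by simp
qed

lemma legendre_at_0_odd:
  "poly (legendre (2 * m + 1)) 0 = 0"
  "(poly (pderiv (legendre (2 * m + 1))) 0)\<^sup>2 = ((2 * real m + 1) * central_prob m)\<^sup>2"
proof -
  show "poly (legendre (2 * m + 1)) 0 = 0"
    unfolding poly_legendre_0 coeff_x2_minus_1_power by simp
  have bin: "(real m + 1) * real (Suc (2 * m) choose Suc m) = (2 * real m + 1) * real ((2 * m) choose m)"
    using arg_cong [OF Suc_times_binomial [of m "2 * m"], of real] by (simp add: algebra_simps)
  have "2 * m + 1 + 1 = 2 * Suc m" by simp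
  then have "poly (pderiv (legendre (2 * m + 1))) 0
      = (-1) ^ (2 * m + 1 + Suc m) * (2 * ((real m + 1) * real (Suc (2 * m) choose Suc m))) / 2 ^ (2 * m + 1)"
    unfolding poly_pderiv_legendre_0
    by (simp only: coeff_x2_minus_1_power) (simp add: field_simps del: binomial_Suc_Suc)
  also have "\<dots> = (-1) ^ (2 * m + 1 + Suc m) * ((2 * real m + 1) * central_prob m)"
    unfolding bin by (simp add: power_mult)
  finally have "poly (pderiv (legendre (2 * m + 1))) 0
      = (-1) ^ (2 * m + 1 + Suc m) * ((2 * real m + 1) * central_prob m)" .
  moreover have "((-1) ^ k * y)\<^sup>2 = y\<^sup>2" for k :: nat and y :: real
    by (simp add: power_mult_distrib flip: power_mult)
  ultimately show "(poly (pderiv (legendre (2 * m + 1))) 0)\<^sup>2 = ((2 * real m + 1) * central_prob m)\<^sup>2"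
    by (simp only:)
qed

text \<open>Finite form of Wallis' product: the two factors have reciprocal successive quotients,
  because \<open>central_prob\<close> changes by the factor
  \<open>(2 m + 1) / (2 m + 2)\<close>.\<close>

lemma wallis_central_prob:
  "(\<Prod>k=1..m. (4 * real k ^ 2) / (4 * real k ^ 2 - 1)) * ((2 * real m + 1) * (central_prob m)\<^sup>2) = 1"
proof (induction m)
  case (Suc m)
  have "real (Suc m) * real ((2 * Suc m) choose Suc m)
      = real (Suc m) * (2 * real (Suc (2 * m) choose Suc m))"
    using Suc_times_binomial [of m "Suc (2 * m)"] binomial_symmetric [of "Suc m" "Suc (2 * m)"]
    by (simp add: algebra_simps)
  moreover have "(real m + 1) * real (Suc (2 * m) choose Suc m) = (2 * real m + 1) * real ((2 * m) choose m)"
    using arg_cong [OF Suc_times_binomial [of m "2 * m"], of real] by (simp add: algebra_simps)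
  ultimately have "(real m + 1) * real ((2 * Suc m) choose Suc m) = 2 * (2 * real m + 1) * real ((2 * m) choose m)"
    by (simp only: of_nat_Suc) (simp add: algebra_simps del: binomial_Suc_Suc)
  then have step: "central_prob (Suc m) = (2 * real m + 1) / (2 * real m + 2) * central_prob m"
    by (simp add: divide_simps del: binomial_Suc_Suc mult_Suc_right)
      (simp add: algebra_simps del: binomial_Suc_Suc mult_Suc_right)
  define W where "W = (\<Prod>k=1..m. (4 * real k ^ 2) / (4 * real k ^ 2 - 1))"
  define b where "b = central_prob m"
  have "(\<Prod>k=1..Suc m. (4 * real k ^ 2) / (4 * real k ^ 2 - 1))
      = W * (4 * (real m + 1) ^ 2 / (4 * (real m + 1) ^ 2 - 1))"
    by (simp add: W_def add.commute)
  also have "4 * (real m + 1) ^ 2 - 1 = (2 * real m + 1) * (2 * real m + 3)"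
    by (simp add: power2_eq_square algebra_simps)
  finally have W: "(\<Prod>k=1..Suc m. (4 * real k ^ 2) / (4 * real k ^ 2 - 1))
      = W * (4 * (real m + 1) ^ 2 / ((2 * real m + 1) * (2 * real m + 3)))" .
  have half: "2 * real m + 2 = 2 * (real m + 1)" by simp
  have "W * (4 * (real m + 1) ^ 2 / ((2 * real m + 1) * (2 * real m + 3)))
      * ((2 * real (Suc m) + 1) * ((2 * real m + 1) / (2 * real m + 2) * b)\<^sup>2)
      = W * ((2 * real m + 1) * b\<^sup>2)"
  proof -
    have nz: "2 * real m + 1 \<noteq> 0" "2 * real m + 3 \<noteq> 0" "real m + 1 \<noteq> 0" by linarith+
    have "2 * real (Suc m) + 1 = 2 * real m + 3" by simp
    then show ?thesis
      unfolding half power_mult_distrib power_divide using nz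
      by (simp add: divide_simps power2_eq_square)
  qed
  then show ?case
    unfolding W step b_def [symmetric] by (simp only: Suc.IH [folded W_def b_def])
qed simp

section \<open>The energy of the transformed equation\<close>

text \<open>The energy \<open>leg_E\<close> at \<open>pi / 2\<close> (see \<open>leg_E_mid\<close>):
  there \<open>- cos t = 0\<close>, and \<open>1/4\<close> is the value of
  \<open>1 / (4 (sin t)^2)\<close>.\<close>

definition legendre_energy :: "nat \<Rightarrow> real" where
  "legendre_energy n =
     (poly (pderiv (legendre n)) 0)\<^sup>2 + ((real n + 1/2)\<^sup>2 + 1/4) * (poly (legendre n) 0)\<^sup>2"

lemma legendre_energy_asymptotic: "(\<lambda>n. legendre_energy n / real n) \<longlonglongrightarrow> 2 / pi"
proof -
  define W where "W m = (\<Prod>k=1..m. (4 * real k ^ 2) / (4 * real k ^ 2 - 1))" for m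
  define V where "V m = (2 * real m + 1) * (central_prob m)\<^sup>2" for m
  have WV: "W m * V m = 1" for m
    unfolding W_def V_def by (rule wallis_central_prob)
  then have V: "V m = 1 / W m" for m
    by (metis mult_zero_left nonzero_mult_div_cancel_left zero_neq_one)
  have "W \<longlonglongrightarrow> pi / 2"
    using wallis unfolding W_def [abs_def] .
  then have "(\<lambda>m. 1 / W m) \<longlonglongrightarrow> 1 / (pi / 2)"
    by (intro tendsto_intros) auto
  then have "V \<longlonglongrightarrow> 2 / pi"
    by (simp add: V [abs_def])
  moreover have "filterlim (\<lambda>n::nat. n div 2) at_top at_top"
    unfolding filterlim_at_top
  proof
    fix Z :: nat
    show "\<forall>\<^sub>F n in sequentially. Z \<le> n div 2"
      using eventually_ge_at_top [of "2 * Z"] by eventually_elim linarith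
  qed
  ultimately have lim: "(\<lambda>n. V (n div 2)) \<longlonglongrightarrow> 2 / pi"
    by (rule filterlim_compose)
  have V0: "V m \<ge> 0" for m by (simp add: V_def)
  \<comment> \<open>For odd \<open>n\<close> the quotient is exactly \<open>V (n div 2)\<close>; for
    even \<open>n\<close> it carries the factor \<open>1 + 1 / (2 n (n + 1))\<close>, coming from
    the extra \<open>1/2\<close> in \<open>n^2 + n + 1/2\<close>.\<close>
  have bounds: "V (n div 2) \<le> legendre_energy n / real n \<and>
      legendre_energy n / real n \<le> V (n div 2) * (1 + 1 / real n)" if "n > 0" for n
  proof (cases "even n")
    case True
    then obtain m where n: "n = 2 * m" by blast
    have m: "real m > 0" using that n by simp
    have "legendre_energy n / real n = V m * (1 + 1 / (2 * real n * (real n + 1)))"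
      unfolding legendre_energy_def n legendre_at_0_even V_def using m
      by (simp add: divide_simps) (simp add: power2_eq_square algebra_simps)
    moreover have "1 / (2 * real n * (real n + 1)) \<le> 1 / real n"
      using that by (simp add: divide_simps)
    moreover have "1 / (2 * real n * (real n + 1)) \<ge> 0" by simp
    ultimately have "V m * 1 \<le> legendre_energy n / real n"
      "legendre_energy n / real n \<le> V m * (1 + 1 / real n)"
      using V0 [of m] by (simp_all only: mult_left_mono add_left_mono le_add_same_cancel1)
    then show ?thesis by (simp add: n)
  next
    case False
    then obtain m where n: "n = 2 * m + 1" by (rule oddE)
    have "legendre_energy n / real n = V m"
      unfolding legendre_energy_def n legendre_at_0_odd V_def
      by (simp add: divide_simps) (simp add: power2_eq_square algebra_simps)
    then show ?thesis
      using V0 [of m] n by (simp add: algebra_simps)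
  qed
  show ?thesis
  proof (rule tendsto_sandwich)
    show "(\<lambda>n. V (n div 2)) \<longlonglongrightarrow> 2 / pi" by (rule lim)
    have "(\<lambda>n. 1 + 1 / real n) \<longlonglongrightarrow> 1 + 0"
      by (intro tendsto_intros lim_1_over_n)
    from tendsto_mult [OF lim this]
    show "(\<lambda>n. V (n div 2) * (1 + 1 / real n)) \<longlonglongrightarrow> 2 / pi" by simp
  qed (rule eventually_mono [OF eventually_gt_at_top [of 0]], use bounds in blast)+
qed

lemma legendre_energy_pos: "legendre_energy n > 0"
proof (cases "even n")
  case True
  then obtain m where n: "n = 2 * m" by blast
  then show ?thesis
    unfolding legendre_energy_def n legendre_at_0_even by (auto intro!: mult_pos_pos add_nonneg_pos)
next
  case False
  then obtain m where n: "n = 2 * m + 1" by (rule oddE)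
  have "(2 * real m + 1) * central_prob m > 0" by (intro mult_pos_pos divide_pos_pos) auto
  then show ?thesis
    unfolding legendre_energy_def n legendre_at_0_odd by simp
qed

text \<open>The zero polynomial would make \<open>legendre_energy\<close> vanish.\<close>

lemma legendre_nonzero: "legendre n \<noteq> 0"
  using legendre_energy_pos [of n] by (auto simp: legendre_energy_def)

text \<open>\<open>- cos t\<close> increases on \<open>(0, pi)\<close>, so angles and roots are
  ordered alike; the factor \<open>sqrt (sin t)\<close> removes the first-order term from Legendre's
  equation.\<close>

definition leg_u :: "nat \<Rightarrow> real \<Rightarrow> real" where
  "leg_u n t = sqrt (sin t) * poly (legendre n) (- cos t)"

definition leg_u' :: "nat \<Rightarrow> real \<Rightarrow> real" where
  "leg_u' n t = cos t / (2 * sqrt (sin t)) * poly (legendre n) (- cos t)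
     + sqrt (sin t) * sin t * poly (pderiv (legendre n)) (- cos t)"

definition leg_q :: "nat \<Rightarrow> real \<Rightarrow> real" where
  "leg_q n t = (real n + 1/2)\<^sup>2 + 1 / (4 * (sin t)\<^sup>2)"

definition leg_E :: "nat \<Rightarrow> real \<Rightarrow> real" where
  "leg_E n t = (leg_u' n t)\<^sup>2 + leg_q n t * (leg_u n t)\<^sup>2"

lemma leg_u_deriv:
  assumes "sin t > 0"
  shows "(leg_u n has_real_derivative leg_u' n t) (at t)"
  unfolding leg_u_def [abs_def] leg_u'_def using assms
  by (auto intro!: derivative_eq_intros poly_DERIV [THEN DERIV_chain2] simp: field_simps)

lemma leg_u'_deriv:
  assumes s: "sin t > 0"
  shows "(leg_u' n has_real_derivative - leg_q n t * leg_u n t) (at t)"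
proof -
  \<comment> \<open>In terms of \<open>r = sqrt (sin t)\<close> all is rational:
    \<open>sin t = r^2\<close> and \<open>(cos t)^2 = 1 - r^4\<close>. Legendre's equation then
    eliminates \<open>P2\<close>.\<close>
  define r where "r = sqrt (sin t)"
  define c where "c = cos t"
  define P0 P1 P2 where "P0 = poly (legendre n) (- c)" and "P1 = poly (pderiv (legendre n)) (- c)"
    and "P2 = poly (pderiv (pderiv (legendre n))) (- c)"
  have r: "r > 0" "sin t = r\<^sup>2" using s by (auto simp: r_def)
  have c2: "c\<^sup>2 = 1 - r ^ 4"
    using sin_cos_squared_add [of t] r by (simp add: c_def)
  have ode: "r ^ 4 * P2 = - 2 * c * P1 - real n * (real n + 1) * P0"
    using legendre_ode [of "- c" n] c2 by (simp add: P0_def P1_def P2_def)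
  have "(leg_u' n has_real_derivative
      ((- (r\<^sup>2) / (2 * r) - c * (c / (2 * r)) / (2 * r\<^sup>2)) * P0 + c / (2 * r) * (P1 * r\<^sup>2)
       + ((c / (2 * r) * r\<^sup>2 + r * c) * P1 + r * r\<^sup>2 * (P2 * r\<^sup>2)))) (at t)"
    unfolding leg_u'_def [abs_def] using s r
    by (auto intro!: derivative_eq_intros poly_DERIV [THEN DERIV_chain2]
        simp: P0_def P1_def P2_def c_def r_def [symmetric] simp del: real_sqrt_pow2)
       (auto simp: field_simps power2_eq_square)
  moreover have "(- (r\<^sup>2) / (2 * r) - c * (c / (2 * r)) / (2 * r\<^sup>2)) * P0 + c / (2 * r) * (P1 * r\<^sup>2)
       + ((c / (2 * r) * r\<^sup>2 + r * c) * P1 + r * r\<^sup>2 * (P2 * r\<^sup>2)) = - leg_q n t * leg_u n t"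
  proof -
    have "r * r\<^sup>2 * (P2 * r\<^sup>2) = r * (r ^ 4 * P2)"
      by (simp add: power2_eq_square power4_eq_xxxx)
    also have "\<dots> = r * (- 2 * c * P1 - real n * (real n + 1) * P0)"
      by (simp only: ode)
    finally have 1: "r * r\<^sup>2 * (P2 * r\<^sup>2) = r * (- 2 * c * P1 - real n * (real n + 1) * P0)" .
    have 2: "c * (c / (2 * r)) / (2 * r\<^sup>2) = (1 - r ^ 4) / (4 * r ^ 3)"
      unfolding c2 [symmetric] by (simp add: power2_eq_square power3_eq_cube)
    \<comment> \<open>\<open>y\<close> collects the terms in \<open>r^-3\<close>. The
      \<open>P1\<close> terms cancel, and the net \<open>- r / 4\<close> completes
      \<open>n (n + 1)\<close> to \<open>(n + 1/2)^2\<close>.\<close>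
    define y where "y = 1 / (4 * r ^ 3)"
    have 3: "(1 - r ^ 4) / (4 * r ^ 3) = y - r / 4" "- (r\<^sup>2) / (2 * r) = - r / 2"
      "c / (2 * r) * (P1 * r\<^sup>2) = r * c * P1 / 2" "c / (2 * r) * r\<^sup>2 = r * c / 2"
      "1 / (4 * r ^ 4) * r = y"
      using r(1) by (simp_all add: y_def divide_simps)
        (simp_all add: power2_eq_square power3_eq_cube power4_eq_xxxx)
    have "leg_q n t * leg_u n t = ((real n + 1/2)\<^sup>2 + 1 / (4 * r ^ 4)) * (r * P0)"
      using r by (simp add: leg_q_def leg_u_def P0_def c_def r_def [symmetric])
    also have "\<dots> = (real n + 1/2)\<^sup>2 * r * P0 + (1 / (4 * r ^ 4) * r) * P0"
      by (simp only: distrib_right mult.assoc)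
    finally have 4: "leg_q n t * leg_u n t = (real n + 1/2)\<^sup>2 * r * P0 + y * P0"
      unfolding 3 .
    show ?thesis
      unfolding 1 2 mult_minus_left 3 4 by (simp add: power2_eq_square algebra_simps)
  qed
  ultimately show ?thesis by simp
qed

text \<open>\<open>u'' = - q u\<close> makes the terms \<open>2 u' u''\<close> and
  \<open>2 q u u'\<close> cancel, so only \<open>q' u^2\<close> survives.\<close>

lemma leg_E_deriv:
  assumes "sin t > 0"
  shows "(leg_E n has_real_derivative - (cos t / (2 * sin t ^ 3)) * (leg_u n t)\<^sup>2) (at t)"
proof -
  have "(leg_q n has_real_derivative - (cos t / (2 * sin t ^ 3))) (at t)"
    unfolding leg_q_def [abs_def] using assms
    by (auto intro!: derivative_eq_intros simp: field_simps power2_eq_square power3_eq_cube)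
  note [derivative_intros] = this leg_u_deriv [OF assms] leg_u'_deriv [OF assms]
  show ?thesis
    unfolding leg_E_def [abs_def]
    by (auto intro!: derivative_eq_intros simp: algebra_simps)
qed

section \<open>Bounds for the energy\<close>

lemma leg_E_mid: "leg_E n (pi / 2) = legendre_energy n"
  by (simp add: leg_E_def leg_u_def leg_u'_def leg_q_def legendre_energy_def)

text \<open>The derivative of the energy is a nonnegative multiple of \<open>- cos t\<close>, so the
  energy falls up to \<open>pi / 2\<close> and rises afterwards.\<close>

lemma leg_E_lower:
  assumes "0 < t" "t < pi"
  shows "legendre_energy n \<le> leg_E n t"
proof (cases "t \<le> pi / 2")
  case True
  have "leg_E n (pi / 2) \<le> leg_E n t"
  proof (rule DERIV_nonpos_imp_nonincreasing [OF True])
    fix x assume x: "t \<le> x" "x \<le> pi / 2"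
    then have s: "sin x > 0" and c: "cos x \<ge> 0"
      using assms by (auto intro!: sin_gt_zero cos_ge_zero)
    show "\<exists>y. (leg_E n has_real_derivative y) (at x) \<and> y \<le> 0"
      using leg_E_deriv [OF s, of n] s c by (auto intro!: exI mult_nonneg_nonneg)
  qed
  then show ?thesis by (simp add: leg_E_mid)
next
  case False
  then have "pi / 2 \<le> t" by simp
  then have "leg_E n (pi / 2) \<le> leg_E n t"
  proof (rule DERIV_nonneg_imp_nondecreasing)
    fix x assume x: "pi / 2 \<le> x" "x \<le> t"
    then have s: "sin x > 0" and c: "- cos x \<ge> 0"
      using assms cos_ge_zero [of "pi - x"] by (auto intro!: sin_gt_zero)
    have "0 \<le> (- cos x) / (2 * sin x ^ 3) * (leg_u n x)\<^sup>2"
      using s c by (intro mult_nonneg_nonneg divide_nonneg_nonneg) auto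
    then have "0 \<le> - (cos x / (2 * sin x ^ 3)) * (leg_u n x)\<^sup>2" by simp
    then show "\<exists>y. (leg_E n has_real_derivative y) (at x) \<and> 0 \<le> y"
      using leg_E_deriv [OF s, of n] by blast
  qed
  then show ?thesis by (simp add: leg_E_mid)
qed

text \<open>Gronwall's argument: on \<open>[d, pi - d]\<close> one has
  \<open>|q'| \<le> 1 / (2 sin d ^ 3)\<close> and \<open>N^2 u^2 \<le> E\<close>, hence
  \<open>|E'| \<le> K E\<close>, with \<open>K\<close> of order \<open>1 / n^2\<close> for fixed
  \<open>d\<close>.\<close>

lemma leg_E_upper:
  fixes n :: nat and d t :: real
  assumes d: "0 < d" and t: "d \<le> t" "t \<le> pi - d"
  defines "K \<equiv> 1 / (2 * sin d ^ 3 * (real n + 1/2)\<^sup>2)"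
  shows "leg_E n t \<le> legendre_energy n * exp (K * pi)"
proof -
  have d2: "d \<le> pi / 2" using t by simp
  have sd: "sin d > 0" using d d2 by (intro sin_gt_zero) auto
  have sx: "sin d \<le> sin x" if "d \<le> x" "x \<le> pi - d" for x
  proof (cases "x \<le> pi / 2")
    case True
    then show ?thesis using that d d2 by (intro sin_monotone_2pi_le) auto
  next
    case False
    have "sin d \<le> sin (pi - x)" using that d d2 False by (intro sin_monotone_2pi_le) auto
    then show ?thesis by simp
  qed
  have key: "\<bar>cos x / (2 * sin x ^ 3) * (leg_u n x)\<^sup>2\<bar> \<le> K * leg_E n x"
    if "d \<le> x" "x \<le> pi - d" for x
  proof -
    have s: "sin x \<ge> sin d" using sx that .
    have "(real n + 1/2)\<^sup>2 * (leg_u n x)\<^sup>2 \<le> leg_E n x"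
      by (simp add: leg_E_def leg_q_def distrib_right add.commute add_increasing2)
    moreover have "\<bar>cos x\<bar> / (2 * sin x ^ 3) \<le> 1 / (2 * sin d ^ 3)"
      using s sd by (intro frac_le mult_left_mono power_mono) (auto simp: abs_cos_le_one)
    ultimately have "(\<bar>cos x\<bar> / (2 * sin x ^ 3)) * ((real n + 1/2)\<^sup>2 * (leg_u n x)\<^sup>2)
        \<le> 1 / (2 * sin d ^ 3) * leg_E n x"
      using sd s by (intro mult_mono) auto
    moreover have "\<bar>cos x / (2 * sin x ^ 3) * (leg_u n x)\<^sup>2\<bar> = \<bar>cos x\<bar> / (2 * sin x ^ 3) * (leg_u n x)\<^sup>2"
      using s sd by (simp add: abs_mult)
    moreover have "(real n + 1/2)\<^sup>2 > 0" by simp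
    moreover have "X * U \<le> 1 / (D * M) * E" if "X * (M * U) \<le> 1 / D * E" "M > 0" for X U D M E :: real
      using divide_right_mono [OF that(1), of M] that(2) by (simp add: mult.commute)
    ultimately show ?thesis
      unfolding K_def by (simp only:)
  qed
  have K: "K \<ge> 0" using sd by (simp add: K_def)
  have E: "legendre_energy n > 0" by (rule legendre_energy_pos)
  show ?thesis
  proof (cases "t \<le> pi / 2")
    case True
    \<comment> \<open>The integrating factor \<open>exp (K x)\<close> makes the energy nondecreasing
      towards \<open>pi / 2\<close>. On the other half the factor is \<open>exp (- (K x))\<close>;
      the crude exponent \<open>K pi\<close> serves both.\<close>
    have "leg_E n t * exp (K * t) \<le> leg_E n (pi / 2) * exp (K * (pi / 2))"
    proof (rule DERIV_nonneg_imp_nondecreasing [OF True])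
      fix x assume x: "t \<le> x" "x \<le> pi / 2"
      then have x': "d \<le> x" "x \<le> pi - d" using t d2 by auto
      have s: "sin x > 0" using sx [OF x'] sd by simp
      have "((\<lambda>x. leg_E n x * exp (K * x)) has_real_derivative
          (- (cos x / (2 * sin x ^ 3) * (leg_u n x)\<^sup>2) + K * leg_E n x) * exp (K * x)) (at x)"
        by (auto intro!: derivative_eq_intros leg_E_deriv [OF s] simp: algebra_simps)
      moreover have "0 \<le> (- (cos x / (2 * sin x ^ 3) * (leg_u n x)\<^sup>2) + K * leg_E n x) * exp (K * x)"
        using key [OF x', THEN abs_le_D1] key [OF x', THEN abs_le_D2]
        by (intro mult_nonneg_nonneg) simp_all
      ultimately show "\<exists>y. ((\<lambda>x. leg_E n x * exp (K * x)) has_real_derivative y) (at x) \<and> 0 \<le> y"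
        by blast
    qed
    moreover have "leg_E n t \<le> leg_E n t * exp (K * t)"
      using leg_E_lower [of t n] E d t K by (auto simp: mult_le_cancel_left1)
    moreover have "leg_E n (pi / 2) * exp (K * (pi / 2)) \<le> leg_E n (pi / 2) * exp (K * pi)"
      using E K by (auto simp: leg_E_mid mult_left_mono)
    ultimately show ?thesis by (simp add: leg_E_mid)
  next
    case False
    then have "pi / 2 \<le> t" by simp
    then have "leg_E n (pi / 2) * exp (- (K * (pi / 2))) \<ge> leg_E n t * exp (- (K * t))"
    proof (rule DERIV_nonpos_imp_nonincreasing)
      fix x assume x: "pi / 2 \<le> x" "x \<le> t"
      then have x': "d \<le> x" "x \<le> pi - d" using t d2 by auto
      have s: "sin x > 0" using sx [OF x'] sd by simp
      have "((\<lambda>x. leg_E n x * exp (- (K * x))) has_real_derivative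
          - ((cos x / (2 * sin x ^ 3) * (leg_u n x)\<^sup>2 + K * leg_E n x) * exp (- (K * x)))) (at x)"
        by (auto intro!: derivative_eq_intros leg_E_deriv [OF s] simp: algebra_simps)
      moreover have "0 \<le> (cos x / (2 * sin x ^ 3) * (leg_u n x)\<^sup>2 + K * leg_E n x) * exp (- (K * x))"
        using key [OF x', THEN abs_le_D1] key [OF x', THEN abs_le_D2]
        by (intro mult_nonneg_nonneg) simp_all
      ultimately show "\<exists>y. ((\<lambda>x. leg_E n x * exp (- (K * x))) has_real_derivative y) (at x) \<and> y \<le> 0"
        using neg_le_0_iff_le by blast
    qed
    then have "leg_E n t \<le> leg_E n (pi / 2) * exp (K * t - K * (pi / 2))"
      using mult_right_mono [of _ _ "exp (K * t)"] by (fastforce simp: mult.assoc mult_exp_exp)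
    moreover have "K * t \<le> K * pi" using K t d by (intro mult_left_mono) auto
    then have "K * t - K * (pi / 2) \<le> K * pi" 
      using mult_nonneg_nonneg [OF K, of "pi / 2"] by simp
    then have "leg_E n (pi / 2) * exp (K * t - K * (pi / 2)) \<le> leg_E n (pi / 2) * exp (K * pi)"
      using E unfolding leg_E_mid by (intro mult_left_mono) (simp_all only: exp_le_cancel_iff less_imp_le)
    ultimately show ?thesis by (simp add: leg_E_mid)
  qed
qed

section \<open>Location of the roots by Sturm comparison\<close>

text \<open>Since \<open>q > N^2\<close>, the Wronskian of \<open>\<sigma> u\<close> with
  \<open>sin (N (t - a))\<close> would strictly decrease, yet it is \<le> 0 at \<open>a\<close> and
  \<ge> 0 at \<open>b\<close>, consecutive zeros of the sine. The factor \<open>\<sigma>\<close>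
  treats both signs at once.\<close>

lemma leg_u_not_constant_sign:
  fixes n :: nat and a b \<sigma> :: real
  defines "N \<equiv> real n + 1/2"
  assumes a: "0 < a" and b: "b = a + pi / N" "b < pi"
    and pos: "\<And>t. a < t \<Longrightarrow> t < b \<Longrightarrow> \<sigma> * leg_u n t > 0"
  shows False
proof -
  have N: "N > 0" by (simp add: N_def)
  define W where "W t = \<sigma> * leg_u' n t * sin (N * (t - a)) - \<sigma> * leg_u n t * (N * cos (N * (t - a)))" for t
  have ab: "a < b" using N b by simp
  have s: "sin t > 0" if "a \<le> t" "t \<le> b" for t
    using that a b by (intro sin_gt_zero) auto
  have W': "(W has_real_derivative - (\<sigma> * leg_u n t * sin (N * (t - a)) / (4 * (sin t)\<^sup>2))) (at t)"
    if "a \<le> t" "t \<le> b" for t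
    unfolding W_def [abs_def]
    by (rule derivative_eq_intros leg_u_deriv leg_u'_deriv s that refl)+
       (simp add: leg_q_def N_def power2_eq_square algebra_simps)
  have contu: "isCont (leg_u n) t" if "a \<le> t" "t \<le> b" for t
    using leg_u_deriv [OF s [OF that]] by (rule DERIV_isCont)
  have "W b < W a"
  proof (rule DERIV_neg_imp_decreasing_open [OF ab])
    fix t assume t: "a < t" "t < b"
    have "N * (t - a) < pi" using t b N by (simp add: field_simps)
    then have "sin (N * (t - a)) > 0" using t N by (intro sin_gt_zero) auto
    then have "\<sigma> * leg_u n t * sin (N * (t - a)) / (4 * (sin t)\<^sup>2) > 0"
      using pos [OF t] s [of t] t by simp
    then show "\<exists>y. (W has_real_derivative y) (at t) \<and> y < 0"
      using W' [of t] t by (intro exI [of _ "- (\<sigma> * leg_u n t * sin (N * (t - a)) / (4 * (sin t)\<^sup>2))"]) simp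
  next
    show "continuous_on {a..b} W"
      by (rule DERIV_atLeastAtMost_imp_continuous_on) (use W' in blast)
  qed
  \<comment> \<open>Positivity passes to the end points as a weak inequality, by continuity;
    \<open>u\<close> may vanish there.\<close>
  moreover have "0 \<le> \<sigma> * leg_u n t" if "t \<in> {a, b}" for t
  proof -
    have "closure {a<..<b} = {a..b}" using ab by simp
    moreover have "continuous_on {a..b} (\<lambda>t. \<sigma> * leg_u n t)"
      using contu by (auto intro!: continuous_intros continuous_at_imp_continuous_on)
    ultimately show ?thesis
      using continuous_ge_on_closure [of "{a<..<b}" "\<lambda>t. \<sigma> * leg_u n t" t 0] pos that ab
      by (auto simp: less_imp_le)
  qed
  then have "0 \<le> \<sigma> * leg_u n a" "0 \<le> \<sigma> * leg_u n b" by auto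
  moreover have "W a = - (\<sigma> * leg_u n a * N)" by (simp add: W_def)
  moreover have "W b = \<sigma> * leg_u n b * N" using N b by (simp add: W_def)
  ultimately show False using N
    by (metis less_le_not_le mult_nonneg_nonneg neg_le_0_iff_le order.trans order_less_imp_le)
qed

lemma legendre_root_in_interval:
  assumes a: "0 < a" and b: "b = a + pi / (real n + 1/2)" "b < pi"
  shows "\<exists>t. a < t \<and> t < b \<and> poly (legendre n) (- cos t) = 0"
proof (rule ccontr)
  assume no: "\<not> ?thesis"
  have s: "sin t > 0" if "a < t" "t < b" for t
    using that a b by (intro sin_gt_zero) auto
  have nz: "leg_u n t \<noteq> 0" if "a < t" "t < b" for t
    using no that s [OF that] by (auto simp: leg_u_def)
  have "0 < pi / (real n + 1/2)" by simp
  then have ab: "a < b" using b by linarith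
  \<comment> \<open>The value at the midpoint serves as the constant \<open>\<sigma>\<close> of the
    comparison.\<close>
  define m where "m = (a + b) / 2"
  have m: "a < m" "m < b" using ab by (auto simp: m_def)
  have cont: "continuous_on {a<..<b} (leg_u n)"
    by (auto intro!: continuous_at_imp_continuous_on DERIV_isCont leg_u_deriv s)
  \<comment> \<open>Without zeros \<open>u\<close> keeps its sign: the image of the interval is
    connected and avoids 0.\<close>
  have "leg_u n m * leg_u n t > 0" if t: "a < t" "t < b" for t
  proof (rule ccontr)
    assume "\<not> ?thesis"
    then have neg: "leg_u n m \<le> 0 \<and> 0 \<le> leg_u n t \<or> leg_u n t \<le> 0 \<and> 0 \<le> leg_u n m"
      by (auto simp: zero_less_mult_iff not_less)
    have "connected (leg_u n ` {a<..<b})"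
      using cont by (intro connected_continuous_image) auto
    moreover have "leg_u n m \<in> leg_u n ` {a<..<b}" "leg_u n t \<in> leg_u n ` {a<..<b}"
      using m t by auto
    ultimately have "0 \<in> leg_u n ` {a<..<b}"
      using neg connectedD_interval by metis
    then show False using nz by auto
  qed
  then show False using leg_u_not_constant_sign [OF a b] by blast
qed

text \<open>The comparison intervals are shifted by a quarter of their length to keep them away from the end
  points of \<open>(0, pi)\<close>, where \<open>u\<close> is not differentiable.\<close>

lemma leg_root_angle:
  assumes k: "1 \<le> k" "k \<le> n"
  obtains t where "(real k - 3/4) * (pi / (real n + 1/2)) < t"
    and "t < (real k + 1/4) * (pi / (real n + 1/2))" and "0 < t" "t < pi"
    and "leg_root k n = - cos t" and "poly (legendre n) (- cos t) = 0"
proof -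
  define h where "h = pi / (real n + 1/2)"
  have h: "h > 0" by (simp add: h_def)
  \<comment> \<open>\<open>(0, pi)\<close> has length \<open>(n + 1/2) h\<close>, so
    \<open>n\<close> intervals of length \<open>h\<close> leave \<open>h / 2\<close>: a margin of
    \<open>h / 4\<close> at each end.\<close>
  have range: "0 < (real j - 3/4) * h \<and> (real j + 1/4) * h < pi" if "j \<in> {1..n}" for j
  proof
    show "0 < (real j - 3/4) * h" using that h by simp
    have "(real j + 1/4) * h < (real n + 1/2) * h"
      using that h by (intro mult_strict_right_mono) auto
    also have "\<dots> = pi" by (simp add: h_def)
    finally show "(real j + 1/4) * h < pi" .
  qed
  have "\<exists>t. (real j - 3/4) * h < t \<and> t < (real j + 1/4) * h \<and> poly (legendre n) (- cos t) = 0"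
    if "j \<in> {1..n}" for j
    using range [OF that]
    by (intro legendre_root_in_interval) (auto simp: h_def [symmetric] algebra_simps)
  then obtain \<theta> where \<theta>: "\<And>j. j \<in> {1..n} \<Longrightarrow> (real j - 3/4) * h < \<theta> j \<and> \<theta> j < (real j + 1/4) * h
      \<and> poly (legendre n) (- cos (\<theta> j)) = 0"
    by metis
  have \<theta>pi: "0 < \<theta> j" "\<theta> j < pi" if "j \<in> {1..n}" for j
    using \<theta> [OF that] range [OF that] by linarith+
  have less: "- cos (\<theta> i) < - cos (\<theta> j)" if "i \<in> {1..n}" "j \<in> {1..n}" "i < j" for i j
  proof -
    have "(real i + 1/4) * h \<le> (real j - 3/4) * h"
      using that h by (intro mult_right_mono) auto
    then have "\<theta> i < \<theta> j" using \<theta> [OF that(1)] \<theta> [OF that(2)] by linarith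
    then show ?thesis
      using \<theta>pi [OF that(1)] \<theta>pi [OF that(2)] by (auto intro!: cos_monotone_0_pi)
  qed
  define xs where "xs = map (\<lambda>j. - cos (\<theta> j)) [1..<n+1]"
  have sorted: "sorted_wrt (<) xs"
    unfolding xs_def sorted_wrt_map
    by (rule sorted_wrt_mono_rel [OF _ sorted_wrt_upt]) (use less in auto)
  have fin: "finite {x. poly (legendre n) x = 0}"
    by (rule poly_roots_finite [OF legendre_nonzero])
  \<comment> \<open>There are \<open>n\<close> distinct roots in \<open>xs\<close> and the degree is
    at most \<open>n\<close>, so no others exist.\<close>
  have "set xs = {x. poly (legendre n) x = 0}"
  proof (rule card_seteq [OF fin])
    show "set xs \<subseteq> {x. poly (legendre n) x = 0}"
      using \<theta> by (auto simp: xs_def)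
    have "card {x. poly (legendre n) x = 0} \<le> degree (legendre n)"
      by (rule card_poly_roots_bound [OF legendre_nonzero])
    also have "\<dots> \<le> n" by (rule degree_legendre_le)
    also have "n = card (set xs)"
      using sorted by (simp add: strict_sorted_iff distinct_card) (simp add: xs_def)
    finally show "card {x. poly (legendre n) x = 0} \<le> card (set xs)" .
  qed
  then have "sorted_list_of_set {x. poly (legendre n) x = 0} = xs"
    using sorted sorted_list_of_set_unique [OF fin] distinct_card strict_sorted_iff by metis
  \<comment> \<open>The indices in \<open>xs\<close> start at 1, so entry \<open>k - 1\<close> is
    the root from the \<open>k\<close>-th interval.\<close>
  then have "leg_root k n = - cos (\<theta> k)"
    unfolding leg_root_def xs_def using k nth_upt [of 1 "k - 1" "n + 1"] by (simp del: upt_Suc)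
  then show thesis
    using that [of "\<theta> k"] \<theta> [of k] \<theta>pi [of k] k by (auto simp: h_def)
qed

text \<open>At a root \<open>u = 0\<close> and \<open>u' = (sin t)^(3/2) P'\<close>; with
  \<open>1 - x^2 = (sin t)^2\<close> the energy is exactly the denominator of the weight.\<close>

lemma w_wt_eq_energy:
  assumes "0 < t" "t < pi" and root: "poly (legendre n) (- cos t) = 0" and k: "leg_root k n = - cos t"
  shows "w_wt k n = 2 / leg_E n t"
proof -
  have s: "sin t > 0" using assms by (intro sin_gt_zero)
  have "(1 - (- cos t)\<^sup>2) powr (3/2) = sin t ^ 3"
  proof -
    have "(1 - (- cos t)\<^sup>2) powr (3/2) = (sin t powr 2) powr (3/2)"
      using s by (simp add: sin_squared_eq powr_numeral)
    also have "\<dots> = sin t ^ 3"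
      using s by (simp only: powr_powr) (simp add: powr_numeral)
    finally show ?thesis .
  qed
  moreover have "leg_E n t = sin t ^ 3 * (poly (pderiv (legendre n)) (- cos t))\<^sup>2"
    using s by (simp add: leg_E_def leg_u_def leg_u'_def root power_mult_distrib power2_eq_square power3_eq_cube)
  ultimately show ?thesis
    unfolding w_wt_def k by simp
qed

text \<open>All that the asymptotics need about a root: its angle up to \<open>O(1 / n)\<close>, and
  the point and the weight in terms of that angle.\<close>

lemma leg_root_approx:
  assumes k: "1 \<le> k" "k \<le> n"
  obtains t where "\<bar>t - pi * real k / real n\<bar> \<le> 2 * pi / real n" "0 < t" "t < pi"
    and "p_pt k n = (1 - cos t) / 2" "w_wt k n = 2 / leg_E n t"
proof -
  define N where "N = real n + 1/2"
  obtain t where t: "(real k - 3/4) * (pi / N) < t" "t < (real k + 1/4) * (pi / N)" "0 < t" "t < pi"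
    "leg_root k n = - cos t" "poly (legendre n) (- cos t) = 0"
    using leg_root_angle [OF k] unfolding N_def by blast
  have n: "real n > 0" and N: "N > 0" using k by (auto simp: N_def)
  have "\<bar>t - real k * (pi / N)\<bar> \<le> pi / N"
    using t(1,2) divide_pos_pos [OF pi_gt_zero N] unfolding abs_le_iff by (simp add: algebra_simps)
  moreover have "pi / N \<le> pi / real n"
    using n by (intro divide_left_mono) (auto simp: N_def)
  \<comment> \<open>Replacing the spacing \<open>pi / N\<close> by \<open>pi / n\<close> moves the
    \<open>k\<close>-th angle by \<open>pi k / (2 n N)\<close>, less than one spacing as
    \<open>k \<le> n\<close>.\<close>
  moreover have "\<bar>real k * (pi / N) - pi * real k / real n\<bar> \<le> pi / real n"
  proof -
    have "pi * real k / real n - real k * (pi / N) = pi / N * (real k / (2 * real n))"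
      using n N by (simp add: field_simps) (simp add: N_def algebra_simps)
    moreover have "pi / N * (real k / (2 * real n)) \<le> pi / N * 1"
      using n N k by (intro mult_left_mono) auto
    moreover have "0 \<le> pi / N * (real k / (2 * real n))"
      using N by simp
    ultimately show ?thesis using \<open>pi / N \<le> pi / real n\<close> by linarith
  qed
  ultimately have "\<bar>t - pi * real k / real n\<bar> \<le> 2 * pi / real n"
    by (simp add: abs_le_iff)
  moreover have "p_pt k n = (1 - cos t) / 2" using t by (simp add: p_pt_def)
  ultimately show thesis using t that w_wt_eq_energy by blast
qed

section \<open>Asymptotics\<close>

lemma abs_cos_diff_le: "\<bar>cos x - cos y\<bar> \<le> \<bar>x - y\<bar>" for x y :: real
proof -
  have "\<bar>cos x - cos y\<bar> = 2 * (\<bar>sin ((x + y) / 2)\<bar> * \<bar>sin ((y - x) / 2)\<bar>)"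
    by (simp add: cos_diff_cos abs_mult)
  also have "\<dots> \<le> 2 * (1 * \<bar>(y - x) / 2\<bar>)"
    by (intro mult_left_mono mult_mono abs_sin_x_le_abs_x abs_sin_le_one) auto
  finally show ?thesis by simp
qed

text \<open>In this range \<open>leg_root\<close> indexes an actual entry of the list of
  roots.\<close>

lemma interior_index:
  assumes "\<alpha> > 0" "\<alpha> * real c < real k" "real k < (1 - \<alpha>) * real c"
  shows "1 \<le> k" "k \<le> c"
proof -
  have "0 \<le> \<alpha> * real c" using assms by simp
  moreover have "(1 - \<alpha>) * real c = real c - \<alpha> * real c" by (simp add: algebra_simps)
  ultimately show "1 \<le> k" "k \<le> c" using assms by linarith+
qed

text \<open>\<open>(1 - cos t) / 2\<close> is the squared sine of the half angle and cosine is
  1-Lipschitz, so an angle error of \<open>2 pi / c\<close> costs at most \<open>pi / c\<close>,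
  uniformly in \<open>k\<close>.\<close>

lemma p_pt_approx:
  assumes k: "1 \<le> k" "k \<le> c"
  shows "\<bar>p_pt k c - (sin (pi * real k / (2 * real c)))\<^sup>2\<bar> \<le> pi / real c"
proof -
  obtain t where t: "\<bar>t - pi * real k / real c\<bar> \<le> 2 * pi / real c" "p_pt k c = (1 - cos t) / 2"
    using leg_root_approx [OF k] by metis
  have "cos (pi * real k / real c) = 1 - 2 * (sin (pi * real k / (2 * real c)))\<^sup>2"
    using cos_double_sin [of "pi * real k / (2 * real c)"] by (simp add: mult.commute)
  then have "p_pt k c - (sin (pi * real k / (2 * real c)))\<^sup>2 = - ((cos t - cos (pi * real k / real c)) / 2)"
    by (simp add: t field_simps)
  then have "\<bar>p_pt k c - (sin (pi * real k / (2 * real c)))\<^sup>2\<bar> = \<bar>cos t - cos (pi * real k / real c)\<bar> / 2"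
    by simp
  also have "\<dots> \<le> (2 * pi / real c) / 2"
    using abs_cos_diff_le [of t "pi * real k / real c"] t(1) by (intro divide_right_mono) auto
  finally show ?thesis by simp
qed

section \<open>Limit of the weights\<close>

lemma scaled_energy_limit: "(\<lambda>c. 2 * real c / legendre_energy c) \<longlonglongrightarrow> pi"
proof -
  have "(\<lambda>c. 2 / (legendre_energy c / real c)) \<longlonglongrightarrow> 2 / (2 / pi)"
    by (intro tendsto_intros legendre_energy_asymptotic) auto
  then show ?thesis by simp
qed

text \<open>The energy is least at \<open>pi / 2\<close>; the bound thus covers the roots near the
  end points as well.\<close>

lemma w_wt_le:
  assumes k: "1 \<le> k" "k \<le> c"
  shows "w_wt k c \<le> 2 / legendre_energy c"
proof -
  obtain t where t: "0 < t" "t < pi" "w_wt k c = 2 / leg_E c t"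
    using leg_root_approx [OF k] by metis
  show ?thesis
    unfolding t(3) using leg_E_lower [OF t(1,2), of c] legendre_energy_pos [of c]
    by (intro divide_left_mono) auto
qed

lemma w_wt_nonneg: "0 \<le> w_wt k c"
  by (simp add: w_wt_def)

text \<open>\<open>c w = 2 c / E t\<close> lies between \<open>2 c / E (pi / 2)\<close> and the same
  times \<open>exp (- (K pi))\<close>; both tend to \<open>pi\<close>.\<close>

lemma w_wt_interior:
  assumes \<alpha>: "\<alpha> > 0" and e: "e > 0"
  shows "\<forall>\<^sub>F c in sequentially. \<forall>k::nat.
            \<alpha> * real c < real k \<and> real k < (1 - \<alpha>) * real c \<longrightarrow>
              \<bar>w_wt k c - pi / real c\<bar> < e / real c"
proof -
  \<comment> \<open>The angles \<open>pi k / c\<close> stay \<open>2 d\<close> away from 0 and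
    \<open>pi\<close>, and the error \<open>2 pi / c\<close> is at most \<open>d\<close> once
    \<open>c \<ge> 4 / \<alpha>\<close>, so the root angles lie in
    \<open>[d, pi - d]\<close>.\<close>
  define d where "d = \<alpha> * pi / 2"
  have d: "d > 0" using \<alpha> by (simp add: d_def)
  define K where "K c = 1 / (2 * sin d ^ 3 * (real c + 1/2)\<^sup>2)" for c :: nat
  have "(\<lambda>c. 1 / (2 * sin d ^ 3) * (inverse (1/2 + real c))\<^sup>2) \<longlonglongrightarrow> 1 / (2 * sin d ^ 3) * 0\<^sup>2"
    by (intro tendsto_mult tendsto_const tendsto_power tendsto_inverse_0_at_top
        filterlim_tendsto_add_at_top [OF tendsto_const] filterlim_real_sequentially)
  then have K: "K \<longlonglongrightarrow> 0"
    by (simp add: K_def [abs_def] power_divide inverse_eq_divide add.commute mult.commute)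
  have "(\<lambda>c. 2 * real c / legendre_energy c * exp (- (K c * pi))) \<longlonglongrightarrow> pi * exp (- (0 * pi))"
    by (intro tendsto_intros scaled_energy_limit K)
  then have lo: "(\<lambda>c. 2 * real c / legendre_energy c * exp (- (K c * pi))) \<longlonglongrightarrow> pi" by simp
  have "\<forall>\<^sub>F c in sequentially. 2 * real c / legendre_energy c < pi + e"
    by (rule order_tendstoD(2) [OF scaled_energy_limit]) (use e in simp)
  moreover have "\<forall>\<^sub>F c in sequentially. pi - e < 2 * real c / legendre_energy c * exp (- (K c * pi))"
    by (rule order_tendstoD(1) [OF lo]) (use e in simp)
  moreover have "\<forall>\<^sub>F c in sequentially. real c \<ge> 4 / \<alpha>"
    using filterlim_real_sequentially unfolding filterlim_at_top by blast
  ultimately show ?thesis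
  proof eventually_elim
    case (elim c)
    show ?case
    proof (intro allI impI, elim conjE)
      fix k assume k: "\<alpha> * real c < real k" "real k < (1 - \<alpha>) * real c"
      note k' = interior_index [OF \<alpha> k]
      then have c: "real c > 0" by linarith
      obtain t where t: "\<bar>t - pi * real k / real c\<bar> \<le> 2 * pi / real c" "0 < t" "t < pi"
        "w_wt k c = 2 / leg_E c t"
        using leg_root_approx [OF k'] by metis
      have "2 * pi / real c = pi * (2 / real c)" by simp
      also have "2 / real c \<le> \<alpha> / 2" using elim(3) \<alpha> c by (simp add: field_simps)
      then have "pi * (2 / real c) \<le> pi * (\<alpha> / 2)" by (intro mult_left_mono) auto
      finally have "2 * pi / real c \<le> d" by (simp add: d_def mult.commute)
      moreover have "\<alpha> \<le> real k / real c" "real k / real c \<le> 1 - \<alpha>"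
        using k c by (simp_all add: field_simps)
      then have "pi * \<alpha> \<le> pi * (real k / real c)" "pi * (real k / real c) \<le> pi * (1 - \<alpha>)"
        by (simp_all only: mult_left_mono pi_ge_zero)
      moreover have "pi * \<alpha> = 2 * d" "pi * (1 - \<alpha>) = pi - 2 * d"
        by (simp_all add: d_def algebra_simps)
      ultimately have dt: "d \<le> t" "t \<le> pi - d"
        using t(1) by (simp_all add: abs_le_iff)
      have E: "legendre_energy c \<le> leg_E c t" "leg_E c t \<le> legendre_energy c * exp (K c * pi)"
        using leg_E_lower [OF t(2,3)] leg_E_upper [OF d dt] by (auto simp: K_def)
      have pos: "legendre_energy c > 0" by (rule legendre_energy_pos)
      have "2 * real c / (legendre_energy c * exp (K c * pi)) \<le> 2 * real c / leg_E c t"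
        using E pos c by (intro divide_left_mono) auto
      then have 1: "pi - e < real c * w_wt k c"
        using elim(2) by (simp add: t(4) exp_minus field_simps)
      have "2 * real c / leg_E c t \<le> 2 * real c / legendre_energy c"
        using E pos c by (intro divide_left_mono) auto
      then have "real c * w_wt k c < pi + e"
        using elim(1) by (simp add: t(4) mult.commute)
      with 1 have "\<bar>real c * w_wt k c - pi\<bar> < e" by linarith
      moreover have "w_wt k c - pi / real c = (real c * w_wt k c - pi) / real c"
        using c by (simp add: field_simps)
      ultimately show "\<bar>w_wt k c - pi / real c\<bar> < e / real c"
        using c by (simp add: abs_divide divide_strict_right_mono)
    qed
  qed
qed

section \<open>Limit of the normalizing constant\<close>

lemma card_interior:
  assumes "\<alpha> > 0" "\<alpha> < 1"
  shows "real c - 2 * \<alpha> * real c - 1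
    \<le> real (card {k \<in> {1..c}. \<alpha> * real c < real k \<and> real k < (1 - \<alpha>) * real c})"
proof -
  define I where "I = {k \<in> {1..c}. \<alpha> * real c < real k \<and> real k < (1 - \<alpha>) * real c}"
  \<comment> \<open>Floor and ceiling round outwards, yet an integer strictly between them is also
    strictly between the real bounds; only the \<open>- 1\<close> of an open range is lost.\<close>
  define l u where "l = nat \<lfloor>\<alpha> * real c\<rfloor>" and "u = nat \<lceil>(1 - \<alpha>) * real c\<rceil>"
  have nn: "0 \<le> \<alpha> * real c" "0 \<le> (1 - \<alpha>) * real c" using assms by simp_all
  have "{l<..<u} \<subseteq> I"
  proof
    fix k assume "k \<in> {l<..<u}"
    then have "int k > \<lfloor>\<alpha> * real c\<rfloor>" "int k < \<lceil>(1 - \<alpha>) * real c\<rceil>"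
      by (auto simp: l_def u_def)
    then have k: "\<alpha> * real c < real k" "real k < (1 - \<alpha>) * real c"
      by (simp_all add: floor_less_iff less_ceiling_iff)
    then show "k \<in> I" using interior_index [OF assms(1) k] by (simp add: I_def)
  qed
  then have "card {l<..<u} \<le> card I" by (intro card_mono) (auto simp: I_def)
  moreover have "real u - real l - 1 \<le> real (card {l<..<u})" by simp
  moreover have "real l \<le> \<alpha> * real c" "(1 - \<alpha>) * real c \<le> real u"
    using nn by (simp_all add: l_def u_def)
  moreover have "(1 - \<alpha>) * real c = real c - \<alpha> * real c" by (simp add: algebra_simps)
  ultimately show ?thesis unfolding I_def [symmetric] by linarith
qed

lemma N_const_limit: "N_const \<longlonglongrightarrow> pi"
proof (rule order_tendstoI)
  fix a :: real assume a: "pi < a"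
  have "\<forall>\<^sub>F c in sequentially. 2 * real c / legendre_energy c < a"
    by (rule order_tendstoD(2) [OF scaled_energy_limit a])
  then show "\<forall>\<^sub>F c in sequentially. N_const c < a"
  proof eventually_elim
    case (elim c)
    have "N_const c \<le> (\<Sum>k=1..c. 2 / legendre_energy c)"
      unfolding N_const_def by (intro sum_mono w_wt_le) auto
    then show ?case using elim by (simp add: mult.commute)
  qed
next
  fix a :: real assume a: "a < pi"
  \<comment> \<open>\<open>\<alpha>\<close> is both the fraction cut off at each end and the
    accuracy of the weights. As \<open>pi < 4\<close>,
    \<open>(1 - 2 \<alpha>) (pi - \<alpha>) \<ge> pi - 9 \<alpha>\<close>, which exceeds
    \<open>a\<close> because \<open>16 \<alpha> \<le> pi - a\<close>.\<close>
  define \<alpha> where "\<alpha> = min (1/4) ((pi - a) / 16)"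
  have \<alpha>: "\<alpha> > 0" "\<alpha> < 1" "16 * \<alpha> \<le> pi - a" using a by (auto simp: \<alpha>_def min_def field_simps)
  have "\<alpha> * pi \<le> \<alpha> * 4" using \<alpha> pi_less_4 by (intro mult_left_mono) auto
  moreover have "(1 - 2 * \<alpha>) * (pi - \<alpha>) = pi - \<alpha> - 2 * (\<alpha> * pi) + 2 * (\<alpha> * \<alpha>)"
    by (simp add: algebra_simps)
  moreover have "\<alpha> * \<alpha> \<ge> 0" by simp
  ultimately have gt: "a < (1 - 2 * \<alpha> - 0) * (pi - \<alpha>)"
    using \<alpha> unfolding diff_0_right by linarith
  have "(\<lambda>c. (1 - 2 * \<alpha> - 1 / real c) * (pi - \<alpha>)) \<longlonglongrightarrow> (1 - 2 * \<alpha> - 0) * (pi - \<alpha>)"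
    by (intro tendsto_intros lim_1_over_n)
  from order_tendstoD(1) [OF this gt]
  have "\<forall>\<^sub>F c in sequentially. a < (1 - 2 * \<alpha> - 1 / real c) * (pi - \<alpha>)" .
  moreover note w_wt_interior [OF \<alpha>(1,1)] eventually_gt_at_top [of 0]
  ultimately show "\<forall>\<^sub>F c in sequentially. a < N_const c"
  proof eventually_elim
    case (elim c)
    define I where "I = {k \<in> {1..c}. \<alpha> * real c < real k \<and> real k < (1 - \<alpha>) * real c}"
    have "pi - \<alpha> > 0" using \<alpha> pi_gt3 by linarith
    \<comment> \<open>Only interior weights are counted, each at least
      \<open>(pi - \<alpha>) / c\<close>; the others are nonnegative.\<close>
    have "(1 - 2 * \<alpha> - 1 / real c) * (pi - \<alpha>) = (real c - 2 * \<alpha> * real c - 1) * ((pi - \<alpha>) / real c)"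
      using elim(3) by (simp add: field_simps)
    also have "\<dots> \<le> real (card I) * ((pi - \<alpha>) / real c)"
      unfolding I_def using card_interior [OF \<alpha>(1,2), of c] \<open>pi - \<alpha> > 0\<close> by (intro mult_right_mono) auto
    also have "\<dots> = (\<Sum>k\<in>I. (pi - \<alpha>) / real c)" by simp
    also have "\<dots> \<le> (\<Sum>k\<in>I. w_wt k c)"
    proof (rule sum_mono)
      fix k assume "k \<in> I"
      then have "\<bar>w_wt k c - pi / real c\<bar> < \<alpha> / real c" using elim(2) by (auto simp: I_def)
      then show "(pi - \<alpha>) / real c \<le> w_wt k c" by (simp add: abs_less_iff diff_divide_distrib)
    qed
    also have "\<dots> \<le> N_const c"
      unfolding N_const_def by (intro sum_mono2) (auto simp: I_def w_wt_nonneg)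
    finally show ?case using elim(1) by simp
  qed
qed

theorem theorem1:
  fixes \<alpha> :: real
  assumes "\<alpha> > 0"
  shows "(\<forall>\<epsilon>>0. \<forall>\<^sub>F c in sequentially. \<forall>k::nat.
            \<alpha> * real c < real k \<and> real k < (1 - \<alpha>) * real c \<longrightarrow>
              \<bar>p_pt k c - (sin (pi * real k / (2 * real c)))\<^sup>2\<bar> < \<epsilon>)
       \<and> (\<forall>\<epsilon>>0. \<forall>\<^sub>F c in sequentially. \<forall>k::nat.
            \<alpha> * real c < real k \<and> real k < (1 - \<alpha>) * real c \<longrightarrow>
              \<bar>w_wt k c - pi / real c\<bar> < \<epsilon> / real c)
       \<and> (N_const \<longlonglongrightarrow> pi)"
proof (intro conjI allI impI)
  fix \<epsilon> :: real assume "\<epsilon> > 0"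
  have "(\<lambda>c. pi * (1 / real c)) \<longlonglongrightarrow> pi * 0"
    by (intro tendsto_intros lim_1_over_n)
  then have "\<forall>\<^sub>F c in sequentially. pi / real c < \<epsilon>"
    using order_tendstoD(2) \<open>\<epsilon> > 0\<close> by fastforce
  then show "\<forall>\<^sub>F c in sequentially. \<forall>k::nat.
            \<alpha> * real c < real k \<and> real k < (1 - \<alpha>) * real c \<longrightarrow>
              \<bar>p_pt k c - (sin (pi * real k / (2 * real c)))\<^sup>2\<bar> < \<epsilon>"
    by eventually_elim (meson assms interior_index p_pt_approx le_less_trans)
qed (use assms w_wt_interior N_const_limit in auto)

end
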